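(* Consider the family of tetranomials $$f_{d,\varepsilon}(x):=x^d-\varepsilon^{-2h}x^2+2\varepsilon^{-(h+1)}x-\varepsilon^{-2}$$ with $h\in\mathbb{N}$, $h\geq 3$, and $d\in\{4,\ldots,\lfloor e^h\rfloor\}$ even. Let $H:=\max\{\varepsilon^{2h},\varepsilon^{-2h}\}$. Then: (i) if $(K,\varepsilon)=(\mathbb{Q}_p,p)$ with $p$ prime, $f_{d,\varepsilon}$ has distinct roots $\zeta_1,\zeta_2\in K$ with $\bigl|\log|\zeta_1-\zeta_2|_p\bigr|=\Omega(d\log H)$; (ii) if $(K,\varepsilon)=(\mathbb{R},1/2)$, $f_{d,\varepsilon}$ has distinct roots $\zeta_1,\zeta_2\in K$ with $\bigl|\log|\zeta_1-\zeta_2|\bigr|=\Omega(d\log H)$. In particular, the coefficients of $p^{2h}f_{d,p}$ (resp. $f_{d,\frac12}$) all lie in $\mathbb{Z}$ and have $O(\log H)$ base-$p$ digits (resp. bits).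
   Context: A tetranomial is a polynomial with exactly $4$ monomial terms. $|\cdot|_p$ is the $p$-adic absolute value normalized so that $|p|_p=1/p$, and $|\cdot|$ is the standard (Archimedean) absolute value. In (i), $H=p^{2h}$ (a real number), and in (ii), $H=2^{2h}$. The implied constants in $\Omega(\cdot)$ and $O(\cdot)$ are absolute. *)

theory Defs
  imports
    Complex_Main
    "HOL-Computational_Algebra.Computational_Algebra"
    "HOL-Library.Log_Nat"
    "HOL-Algebra.QuotRing"
begin

definition padic_val_rat :: "nat \<Rightarrow> rat \<Rightarrow> int" where
  "padic_val_rat p x =
     int (multiplicity (int p) (fst (quotient_of x)))
     - int (multiplicity (int p) (snd (quotient_of x)))"

definition padic_abs_rat :: "nat \<Rightarrow> rat \<Rightarrow> real" where
  "padic_abs_rat p x = (if x = 0 then 0 else real p powi (- padic_val_rat p x))"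

text \<open>
  The field of p-adic numbers is the completion of the rationals with respect to
  \<open>padic_abs_rat p\<close>: the ring of Cauchy sequences modulo the ideal of null sequences. It is
  a carrier-based ring rather than a type because p is a bound variable of the statement (the
  implied constants must not depend on p).
\<close>

definition padic_Cauchy_ring :: "nat \<Rightarrow> (nat \<Rightarrow> rat) ring" where
  "padic_Cauchy_ring p =
     \<lparr>carrier = {x. \<forall>e>0. \<exists>N. \<forall>m\<ge>N. \<forall>n\<ge>N. padic_abs_rat p (x m - x n) < e},
      monoid.mult = (\<lambda>x y n. x n * y n),
      one = (\<lambda>n. 1),
      ring.zero = (\<lambda>n. 0),
      ring.add = (\<lambda>x y n. x n + y n)\<rparr>"

definition padic_null :: "nat \<Rightarrow> (nat \<Rightarrow> rat) set" where
  "padic_null p = {x. (\<lambda>n. padic_abs_rat p (x n)) \<longlonglongrightarrow> 0}"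

definition Qp :: "nat \<Rightarrow> (nat \<Rightarrow> rat) set ring" where
  "Qp p = padic_Cauchy_ring p Quot padic_null p"

definition Qp_of_rat :: "nat \<Rightarrow> rat \<Rightarrow> (nat \<Rightarrow> rat) set" where
  "Qp_of_rat p r = padic_null p +>\<^bsub>padic_Cauchy_ring p\<^esub> (\<lambda>n. r)"

definition Qp_abs :: "nat \<Rightarrow> (nat \<Rightarrow> rat) set \<Rightarrow> real" where
  "Qp_abs p X = (THE r. \<forall>x\<in>X. (\<lambda>n. padic_abs_rat p (x n)) \<longlonglongrightarrow> r)"

text \<open>Evaluation at a p-adic point of a polynomial with rational coefficients.\<close>

definition Qp_poly :: "nat \<Rightarrow> rat poly \<Rightarrow> (nat \<Rightarrow> rat) set \<Rightarrow> (nat \<Rightarrow> rat) set" where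
  "Qp_poly p f x =
     (\<Oplus>\<^bsub>Qp p\<^esub>i\<in>{..degree f}. Qp_of_rat p (coeff f i) \<otimes>\<^bsub>Qp p\<^esub> (x [^]\<^bsub>Qp p\<^esub> i))"

definition tetranomial :: "'a::zero poly \<Rightarrow> bool" where
  "tetranomial f \<longleftrightarrow> card {i. coeff f i \<noteq> 0} = 4"

definition ftet :: "nat \<Rightarrow> nat \<Rightarrow> 'a::field \<Rightarrow> 'a poly" where
  "ftet h d \<epsilon> =
     monom 1 d - monom (\<epsilon> powi (- 2 * int h)) 2
     + monom (2 * \<epsilon> powi (- (int h + 1))) 1 - monom (\<epsilon> powi (- 2)) 0"

definition Hmax :: "nat \<Rightarrow> real \<Rightarrow> real" where
  "Hmax h \<epsilon> = max (\<epsilon> powi (2 * int h)) (\<epsilon> powi (- 2 * int h))"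

definition admissible :: "nat \<Rightarrow> nat \<Rightarrow> bool" where
  "admissible h d \<longleftrightarrow> h \<ge> 3 \<and> d \<in> {4..nat \<lfloor>exp (real h)\<rfloor>} \<and> even d"

end

theory Submission imports Defs begin

text \<open>
  The tetranomial is a difference of squares: with \<open>d = 2 * m\<close>,
  \<open>f(x) = (x^m)^2 - (\<epsilon>^(-h) * x - \<epsilon>^(-1))^2\<close>. The second square vanishes at
  \<open>x = \<epsilon>^(h-1)\<close>, where \<open>x^m\<close> is tiny, so one expects two roots of \<open>f\<close> very close to that point,
  one for each sign of the square root. Writing \<open>x = \<epsilon>^(h-1) * (1 + y)\<close> turns \<open>f(x) = 0\<close> into the
  two fixed point equations \<open>y = \<epsilon>^M * (1 + y)^m\<close> and \<open>y = - \<epsilon>^M * (1 + y)^m\<close> with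
  \<open>M = (h-1) * m + 1\<close> (\<open>poly_ftet_scaled\<close>). Their solutions have size about \<open>\<bar>\<epsilon>\<bar>^M\<close>, and
  \<open>M\<close> is of order \<open>d * h\<close>, which is what makes the logarithm of the distance of the two roots
  comparable to \<open>d * log H\<close> (\<open>separation_bound\<close>).

  Over the reals the two solutions come from the intermediate value theorem (\<open>real_close_roots\<close>).

  Over the p-adic numbers the maps \<open>y \<mapsto> q * (1 + y)^m\<close> with \<open>q = p^M\<close> or \<open>q = - p^M\<close> are
  contractions of the integers, and iterating them from \<open>0\<close> gives Cauchy sequences of integers
  whose limits are the wanted solutions (\<open>root_seq\<close>, \<open>padic_root_seq_root\<close>). The distance of the
  limits can be read off from the iterates, since \<open>p^M * ((1 + y)^m + (1 + y')^m)\<close> has absolute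
  value exactly \<open>\<bar>2 * p^M\<bar>\<close> for small \<open>y\<close> and \<open>y'\<close> (\<open>padic_root_seq_separation\<close>). To transfer these
  computations to the completion it suffices that the Cauchy sequences form a commutative ring in
  which the null sequences are an ideal: passing to the quotient is then a ring homomorphism, so
  evaluating a polynomial at a limit is done termwise (\<open>Qp_poly_padic_limit\<close>), and the
  absolute value of a limit is the limit of the absolute values (\<open>Qp_abs_padic_limit\<close>).

  The digit bounds hold because the integral coefficients are at most \<open>H\<close> in absolute value.
\<close>

section \<open>The p-adic absolute value on the rationals\<close>

lemma padic_abs_rat_0 [simp]: "padic_abs_rat p 0 = 0"
  by (simp add: padic_abs_rat_def)

context
  fixes p :: nat
  assumes p: "prime p"
begin

lemma prime_gt_1_real: "real p > 1"
  using prime_gt_1_nat[OF p] by simp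

text \<open>
  The valuation is defined through the reduced fraction; freeing it from reducedness is what makes
  multiplicativity a computation.
\<close>

lemma padic_val_rat_Fract:
  assumes "a \<noteq> 0" "b \<noteq> 0"
  shows "padic_val_rat p (Rat.Fract a b) = int (multiplicity (int p) a) - int (multiplicity (int p) b)"
proof -
  obtain c e where q: "quotient_of (Rat.Fract a b) = (c, e)" by force
  have e: "e > 0" using quotient_of_denom_pos[OF q] .
  have eq: "Rat.Fract a b = Rat.Fract c e"
    using quotient_of_div[OF q] by (simp add: Fract_of_int_quotient)
  hence "a * e = c * b" using assms e by (simp add: eq_rat)
  moreover from this have "c \<noteq> 0" using assms e by auto
  moreover have pe: "prime_elem (int p)" using p by simp
  ultimately have "multiplicity (int p) a + multiplicity (int p) e
                 = multiplicity (int p) c + multiplicity (int p) b"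
    using assms e
    by (metis less_irrefl prime_elem_multiplicity_mult_distrib)
  thus ?thesis unfolding padic_val_rat_def q by simp
qed

lemma padic_abs_rat_mult:
  "padic_abs_rat p (x * y) = padic_abs_rat p x * padic_abs_rat p y"
proof (cases "x = 0 \<or> y = 0")
  case False
  obtain a b where x: "x = Rat.Fract a b" "b > 0" by (cases x) auto
  obtain c e where y: "y = Rat.Fract c e" "e > 0" by (cases y) auto
  have nz: "a \<noteq> 0" "c \<noteq> 0" using False x y by (auto simp: rat_number_collapse)
  have pe: "prime_elem (int p)" using p by simp
  have "padic_val_rat p (x * y) = padic_val_rat p x + padic_val_rat p y"
    using x y nz pe by (simp add: padic_val_rat_Fract prime_elem_multiplicity_mult_distrib)
  thus ?thesis using False prime_gt_1_nat[OF p]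
    by (simp add: padic_abs_rat_def power_int_diff power_int_minus field_simps)
qed auto

lemma padic_abs_rat_nonneg: "padic_abs_rat p x \<ge> 0"
  using prime_gt_1_real by (simp add: padic_abs_rat_def)

lemma padic_abs_rat_eq_0_iff: "padic_abs_rat p x = 0 \<longleftrightarrow> x = 0"
  using prime_gt_1_real by (simp add: padic_abs_rat_def)

lemma padic_abs_rat_1 [simp]: "padic_abs_rat p 1 = 1"
  by (simp add: padic_abs_rat_def padic_val_rat_def)

lemma padic_abs_rat_minus [simp]: "padic_abs_rat p (- x) = padic_abs_rat p x"
proof -
  have "padic_abs_rat p (-1) ^ 2 = 1"
    using padic_abs_rat_mult[of "-1" "-1"] by (simp add: power2_eq_square)
  hence "padic_abs_rat p (-1) = 1" 
    using padic_abs_rat_nonneg[of "-1"] by (simp add: power2_eq_1_iff)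
  thus ?thesis using padic_abs_rat_mult[of "-1" x] by simp
qed

lemma padic_abs_rat_diff_commute: "padic_abs_rat p (x - y) = padic_abs_rat p (y - x)"
  using padic_abs_rat_minus[of "x - y"] by simp

lemma padic_abs_rat_power: "padic_abs_rat p (x ^ n) = padic_abs_rat p x ^ n"
  by (induction n) (simp_all add: padic_abs_rat_mult)

lemma padic_abs_rat_of_int:
  "a \<noteq> 0 \<Longrightarrow> padic_abs_rat p (of_int a) = 1 / real p ^ multiplicity (int p) a"
  by (simp add: padic_abs_rat_def padic_val_rat_def power_int_minus inverse_eq_divide)

lemma padic_abs_rat_of_int_le_iff:
  "padic_abs_rat p (of_int a) \<le> 1 / real p ^ k \<longleftrightarrow> int p ^ k dvd a"
proof (cases "a = 0")
  case False
  have "\<not> is_unit (int p)" using prime_gt_1_nat[OF p] by simp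
  thus ?thesis using False prime_gt_1_real
    by (simp add: padic_abs_rat_of_int field_simps power_increasing_iff power_dvd_iff_le_multiplicity)
qed (use prime_gt_1_real in auto)

lemma padic_abs_rat_of_int_le_1: "padic_abs_rat p (of_int a) \<le> 1"
  using padic_abs_rat_of_int_le_iff[of a 0] by simp

lemma padic_abs_rat_prime: "padic_abs_rat p (of_nat p) = 1 / real p"
  using padic_abs_rat_of_int[of "int p"] p prime_gt_1_nat[OF p] by simp

lemma padic_abs_rat_add_int_le:
  assumes "padic_abs_rat p (of_int a) \<le> padic_abs_rat p (of_int b)"
  shows "padic_abs_rat p (of_int (a + b)) \<le> padic_abs_rat p (of_int b)"
proof (cases "b = 0")
  case False
  thus ?thesis using assms
    unfolding padic_abs_rat_of_int[OF False] padic_abs_rat_of_int_le_iff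
    by (simp add: multiplicity_dvd)
next
  case True
  thus ?thesis using assms padic_abs_rat_nonneg[of "of_int a"] padic_abs_rat_eq_0_iff[of "of_int a"]
    by simp
qed

text \<open>
  The ultrametric inequality on integers says that a sum is divisible by the common powers of \<open>p\<close>;
  a common denominator reduces rational numbers to that case.
\<close>

lemma padic_abs_rat_add_le:
  "padic_abs_rat p (x + y) \<le> max (padic_abs_rat p x) (padic_abs_rat p y)"
proof -
  obtain a b where x: "x = Rat.Fract a b" "b > 0" by (cases x) auto
  obtain c e where y: "y = Rat.Fract c e" "e > 0" by (cases y) auto
  define D where "D = padic_abs_rat p (of_int (b * e))"
  have D: "D > 0" 
    using x y padic_abs_rat_nonneg[of "of_int (b*e)"] padic_abs_rat_eq_0_iff[of "of_int (b*e)"] 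
    unfolding D_def by auto
  have X: "of_int (a * e) = x * of_int (b * e)" and Y: "of_int (c * b) = y * of_int (b * e)"
    using x y by (simp_all add: Fract_of_int_quotient field_simps)
  have XY: "of_int (a * e + c * b) = (x + y) * of_int (b * e)"
    unfolding of_int_add X Y by (simp add: algebra_simps)
  have "padic_abs_rat p (of_int (a * e + c * b))
      \<le> max (padic_abs_rat p (of_int (a * e))) (padic_abs_rat p (of_int (c * b)))"
    using padic_abs_rat_add_int_le[of "a*e" "c*b"] padic_abs_rat_add_int_le[of "c*b" "a*e"]
    by (metis add.commute le_max_iff_disj linorder_linear)
  hence "padic_abs_rat p (x + y) * D \<le> max (padic_abs_rat p x) (padic_abs_rat p y) * D"
    unfolding X Y XY padic_abs_rat_mult D_def[symmetric] using D
    by (simp add: max_mult_distrib_right)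
  thus ?thesis using D by simp
qed

lemma padic_abs_rat_add_less:
  "padic_abs_rat p x < e \<Longrightarrow> padic_abs_rat p y < e \<Longrightarrow> padic_abs_rat p (x + y) < e"
  using padic_abs_rat_add_le[of x y] by auto

lemma padic_abs_rat_add_eq:
  assumes "padic_abs_rat p y < padic_abs_rat p x"
  shows "padic_abs_rat p (x + y) = padic_abs_rat p x"
  using padic_abs_rat_add_le[of x y] padic_abs_rat_add_le[of "x + y" "- y"] assms by auto

lemma padic_abs_rat_triangle:
  "padic_abs_rat p (x + y) \<le> padic_abs_rat p x + padic_abs_rat p y"
  using padic_abs_rat_add_le[of x y] padic_abs_rat_nonneg[of x] padic_abs_rat_nonneg[of y] by auto

section \<open>Cauchy sequences and the field of p-adic numbers\<close>

lemma carrier_CauchyI: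
  assumes "\<And>e. e > 0 \<Longrightarrow> \<exists>N. \<forall>m\<ge>N. \<forall>n\<ge>N. padic_abs_rat p (x m - x n) < e"
  shows "x \<in> carrier (padic_Cauchy_ring p)"
  using assms by (simp add: padic_Cauchy_ring_def)

lemma carrier_CauchyD:
  assumes "x \<in> carrier (padic_Cauchy_ring p)" "e > 0"
  obtains N where "\<And>m n. m \<ge> N \<Longrightarrow> n \<ge> N \<Longrightarrow> padic_abs_rat p (x m - x n) < e"
  using assms unfolding padic_Cauchy_ring_def by simp blast

text \<open>
  A bound on a tail replaces a bound on the whole sequence: products only matter eventually, both
  for being Cauchy and for being null.
\<close>

lemma Cauchy_eventually_bounded:
  assumes "x \<in> carrier (padic_Cauchy_ring p)"
  obtains N B where "B > 0" "\<And>n. n \<ge> N \<Longrightarrow> padic_abs_rat p (x n) \<le> B"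
proof -
  obtain N where N: "\<And>m n. m \<ge> N \<Longrightarrow> n \<ge> N \<Longrightarrow> padic_abs_rat p (x m - x n) < 1"
    using carrier_CauchyD[OF assms, of 1] by auto
  have "padic_abs_rat p (x n) \<le> 1 + padic_abs_rat p (x N)" if "n \<ge> N" for n
    using padic_abs_rat_triangle[of "x n - x N" "x N"] N[OF that order.refl] by simp
  thus thesis using that[of "1 + padic_abs_rat p (x N)" N] padic_abs_rat_nonneg[of "x N"] by simp
qed

lemma Cauchy_add:
  assumes "x \<in> carrier (padic_Cauchy_ring p)" "y \<in> carrier (padic_Cauchy_ring p)"
  shows "(\<lambda>n. x n + y n) \<in> carrier (padic_Cauchy_ring p)"
proof (rule carrier_CauchyI)
  fix e :: real assume e: "e > 0"
  obtain N where N: "\<And>m n. m \<ge> N \<Longrightarrow> n \<ge> N \<Longrightarrow> padic_abs_rat p (x m - x n) < e"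
    using carrier_CauchyD[OF assms(1) e] by blast
  obtain N' where N': "\<And>m n. m \<ge> N' \<Longrightarrow> n \<ge> N' \<Longrightarrow> padic_abs_rat p (y m - y n) < e"
    using carrier_CauchyD[OF assms(2) e] by blast
  show "\<exists>N. \<forall>m\<ge>N. \<forall>n\<ge>N. padic_abs_rat p (x m + y m - (x n + y n)) < e"
    using padic_abs_rat_add_less[OF N N'] 
    by (intro exI[of _ "max N N'"]) (simp add: algebra_simps)
qed

lemma Cauchy_mult:
  assumes "x \<in> carrier (padic_Cauchy_ring p)" "y \<in> carrier (padic_Cauchy_ring p)"
  shows "(\<lambda>n. x n * y n) \<in> carrier (padic_Cauchy_ring p)"
proof (rule carrier_CauchyI)
  fix e :: real assume e: "e > 0"
  obtain K B where B: "B > 0" "\<And>n. n \<ge> K \<Longrightarrow> padic_abs_rat p (x n) \<le> B"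
    using Cauchy_eventually_bounded[OF assms(1)] by blast
  obtain K' B' where B': "B' > 0" "\<And>n. n \<ge> K' \<Longrightarrow> padic_abs_rat p (y n) \<le> B'"
    using Cauchy_eventually_bounded[OF assms(2)] by blast
  obtain N where N: "\<And>m n. m \<ge> N \<Longrightarrow> n \<ge> N \<Longrightarrow> padic_abs_rat p (x m - x n) < e / B'"
    using carrier_CauchyD[OF assms(1), of "e / B'"] e B' by auto
  obtain N' where N': "\<And>m n. m \<ge> N' \<Longrightarrow> n \<ge> N' \<Longrightarrow> padic_abs_rat p (y m - y n) < e / B"
    using carrier_CauchyD[OF assms(2), of "e / B"] e B by auto
  have "padic_abs_rat p (x m * y m - x n * y n) < e"
    if "m \<ge> Max {K, K', N, N'}" "n \<ge> Max {K, K', N, N'}" for m n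
  proof -
    have "padic_abs_rat p ((x m - x n) * y m) \<le> padic_abs_rat p (x m - x n) * B'"
      unfolding padic_abs_rat_mult using B' that padic_abs_rat_nonneg by (auto intro: mult_left_mono)
    also have "\<dots> < e" using N[of m n] that B' by (simp add: field_simps)
    finally have 1: "padic_abs_rat p ((x m - x n) * y m) < e" .
    have "padic_abs_rat p (x n * (y m - y n)) \<le> B * padic_abs_rat p (y m - y n)"
      unfolding padic_abs_rat_mult using B that padic_abs_rat_nonneg by (auto intro: mult_right_mono)
    also have "\<dots> < e" using N'[of m n] that B by (simp add: field_simps)
    finally have 2: "padic_abs_rat p (x n * (y m - y n)) < e" .
    show ?thesis using padic_abs_rat_add_less[OF 1 2] by (simp add: algebra_simps)
  qed
  thus "\<exists>N. \<forall>m\<ge>N. \<forall>n\<ge>N. padic_abs_rat p (x m * y m - x n * y n) < e" by blast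
qed

lemma Cauchy_const: "(\<lambda>n. r) \<in> carrier (padic_Cauchy_ring p)"
  by (auto intro!: carrier_CauchyI)

lemma Cauchy_uminus:
  assumes "x \<in> carrier (padic_Cauchy_ring p)"
  shows "(\<lambda>n. - x n) \<in> carrier (padic_Cauchy_ring p)"
  using Cauchy_mult[OF Cauchy_const[of "-1"] assms] by simp

lemma Cauchy_ring_simps [simp]:
  "x \<otimes>\<^bsub>padic_Cauchy_ring p\<^esub> y = (\<lambda>n. x n * y n)"
  "x \<oplus>\<^bsub>padic_Cauchy_ring p\<^esub> y = (\<lambda>n. x n + y n)"
  "\<one>\<^bsub>padic_Cauchy_ring p\<^esub> = (\<lambda>n. 1)"
  "\<zero>\<^bsub>padic_Cauchy_ring p\<^esub> = (\<lambda>n. 0)"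
  by (simp_all add: padic_Cauchy_ring_def)

lemma cring_padic_Cauchy_ring: "cring (padic_Cauchy_ring p)"
proof (rule cringI)
  show "abelian_group (padic_Cauchy_ring p)"
  proof (rule abelian_groupI)
    fix x assume x: "x \<in> carrier (padic_Cauchy_ring p)"
    show "\<exists>y\<in>carrier (padic_Cauchy_ring p). y \<oplus>\<^bsub>padic_Cauchy_ring p\<^esub> x = \<zero>\<^bsub>padic_Cauchy_ring p\<^esub>"
      using Cauchy_uminus[OF x] by (intro bexI[of _ "\<lambda>n. - x n"]) auto
  qed (auto simp: Cauchy_add Cauchy_const algebra_simps)
  show "comm_monoid (padic_Cauchy_ring p)"
    by (rule comm_monoidI) (auto simp: Cauchy_mult Cauchy_const algebra_simps)
qed (auto simp: algebra_simps)

interpretation C: cring "padic_Cauchy_ring p" by (rule cring_padic_Cauchy_ring)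

lemma Cauchy_ring_a_inv:
  assumes "x \<in> carrier (padic_Cauchy_ring p)"
  shows "\<ominus>\<^bsub>padic_Cauchy_ring p\<^esub> x = (\<lambda>n. - x n)"
  using C.minus_equality[of "\<lambda>n. - x n" x] assms Cauchy_uminus[OF assms] by simp

lemma Cauchy_ring_pow:
  assumes "x \<in> carrier (padic_Cauchy_ring p)"
  shows "x [^]\<^bsub>padic_Cauchy_ring p\<^esub> (i::nat) = (\<lambda>n. x n ^ i)"
  by (induction i) (simp_all add: mult.commute)

lemma Cauchy_ring_finsum:
  assumes "finite A" "\<And>i. i \<in> A \<Longrightarrow> g i \<in> carrier (padic_Cauchy_ring p)"
  shows "finsum (padic_Cauchy_ring p) g A = (\<lambda>n. \<Sum>i\<in>A. g i n)"
  using assms by (induction A rule: finite_induct) (auto simp: C.finsum_insert Pi_def)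

lemma padic_nullI:
  assumes "eventually (\<lambda>n. padic_abs_rat p (x n) \<le> b n) sequentially" "b \<longlonglongrightarrow> 0"
  shows "x \<in> padic_null p"
  unfolding padic_null_def mem_Collect_eq
  by (rule tendsto_sandwich[OF _ assms(1) tendsto_const assms(2)]) (simp add: padic_abs_rat_nonneg)

lemma padic_null_add:
  assumes "x \<in> padic_null p" "y \<in> padic_null p"
  shows "(\<lambda>n. x n + y n) \<in> padic_null p"
proof (rule padic_nullI)
  show "\<forall>\<^sub>F n in sequentially. padic_abs_rat p (x n + y n) \<le> padic_abs_rat p (x n) + padic_abs_rat p (y n)"
    by (simp add: padic_abs_rat_triangle)
  show "(\<lambda>n. padic_abs_rat p (x n) + padic_abs_rat p (y n)) \<longlonglongrightarrow> 0"
    using tendsto_add[of _ 0 sequentially _ 0] assms by (simp add: padic_null_def)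
qed

lemma padic_null_mult:
  assumes "x \<in> padic_null p" "y \<in> carrier (padic_Cauchy_ring p)"
  shows "(\<lambda>n. x n * y n) \<in> padic_null p"
proof -
  obtain K B where B: "B > 0" "\<And>n. n \<ge> K \<Longrightarrow> padic_abs_rat p (y n) \<le> B"
    using Cauchy_eventually_bounded[OF assms(2)] by blast
  show ?thesis
  proof (rule padic_nullI)
    show "\<forall>\<^sub>F n in sequentially. padic_abs_rat p (x n * y n) \<le> padic_abs_rat p (x n) * B"
      unfolding padic_abs_rat_mult eventually_sequentially
      using B padic_abs_rat_nonneg by (auto intro!: exI[of _ K] mult_left_mono)
    show "(\<lambda>n. padic_abs_rat p (x n) * B) \<longlonglongrightarrow> 0"
      using tendsto_mult_left_zero[of "\<lambda>n. padic_abs_rat p (x n)"] assms by (simp add: padic_null_def)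
  qed
qed

lemma padic_null_Cauchy:
  assumes "x \<in> padic_null p"
  shows "x \<in> carrier (padic_Cauchy_ring p)"
proof (rule carrier_CauchyI)
  fix e :: real assume "e > 0"
  then obtain N where "\<And>n. n \<ge> N \<Longrightarrow> padic_abs_rat p (x n) < e"
    using assms padic_abs_rat_nonneg unfolding padic_null_def LIMSEQ_def by fastforce
  thus "\<exists>N. \<forall>m\<ge>N. \<forall>n\<ge>N. padic_abs_rat p (x m - x n) < e"
    using padic_abs_rat_add_less[of "x m" e "- x n" for m n] by (intro exI[of _ N]) simp
qed

lemma ideal_padic_null: "ideal (padic_null p) (padic_Cauchy_ring p)"
proof (rule idealI)
  show "ring (padic_Cauchy_ring p)" by (rule C.ring_axioms)
  show "subgroup (padic_null p) (add_monoid (padic_Cauchy_ring p))"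
  proof (rule C.add.subgroupI)
    show "padic_null p \<noteq> {}" 
      using padic_nullI[of "\<lambda>n. 0" "\<lambda>n. 0"] by auto
  next
    fix x assume x: "x \<in> padic_null p"
    thus "\<ominus>\<^bsub>padic_Cauchy_ring p\<^esub> x \<in> padic_null p"
      by (simp add: Cauchy_ring_a_inv padic_null_Cauchy) (simp add: padic_null_def)
  qed (auto simp: padic_null_Cauchy padic_null_add)
next
  fix a x assume "a \<in> padic_null p" "x \<in> carrier (padic_Cauchy_ring p)"
  from padic_null_mult[OF this]
  show "x \<otimes>\<^bsub>padic_Cauchy_ring p\<^esub> a \<in> padic_null p" "a \<otimes>\<^bsub>padic_Cauchy_ring p\<^esub> x \<in> padic_null p"
    by (simp_all add: mult.commute)
qed

interpretation N: ideal "padic_null p" "padic_Cauchy_ring p" by (rule ideal_padic_null)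

text \<open>The canonical projection to the quotient, read as forming the limit of a Cauchy sequence.\<close>

definition "padic_limit x = padic_null p +>\<^bsub>padic_Cauchy_ring p\<^esub> x"

interpretation L: ring_hom_cring "padic_Cauchy_ring p" "Qp p" padic_limit
  using N.rcos_ring_hom_cring[OF cring_padic_Cauchy_ring] unfolding Qp_def padic_limit_def[abs_def] .

lemma padic_limit_closed:
  "x \<in> carrier (padic_Cauchy_ring p) \<Longrightarrow> padic_limit x \<in> carrier (Qp p)"
  by (rule L.hom_closed)

lemma padic_limit_eq_zero:
  assumes "x \<in> padic_null p"
  shows "padic_limit x = \<zero>\<^bsub>Qp p\<^esub>"
  using C.a_rcos_zero[OF ideal_padic_null assms] by (simp add: Qp_def padic_limit_def FactRing_def)

text \<open>
  The projection commutes with sums, products and powers, and these are termwise on sequences.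
\<close>

lemma Qp_poly_padic_limit:
  assumes x: "x \<in> carrier (padic_Cauchy_ring p)"
  shows "Qp_poly p f (padic_limit x) = padic_limit (\<lambda>n. poly f (x n))"
proof -
  have car: "(\<lambda>n. coeff f i * x n ^ i) \<in> carrier (padic_Cauchy_ring p)" for i
    using C.m_closed[OF Cauchy_const C.nat_pow_closed[OF x, of i], of "coeff f i"] 
    by (simp add: Cauchy_ring_pow[OF x])
  have "Qp_of_rat p (coeff f i) \<otimes>\<^bsub>Qp p\<^esub> (padic_limit x [^]\<^bsub>Qp p\<^esub> i)
      = padic_limit (\<lambda>n. coeff f i * x n ^ i)" for i
  proof -
    have "padic_limit x [^]\<^bsub>Qp p\<^esub> i = padic_limit (\<lambda>n. x n ^ i)"
      using L.ring.hom_nat_pow[OF x, of i] Cauchy_ring_pow[OF x, of i] by simp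
    thus ?thesis
      using L.hom_mult[OF Cauchy_const C.nat_pow_closed[OF x, of i], of "coeff f i"] 
      by (simp add: Cauchy_ring_pow[OF x] Qp_of_rat_def padic_limit_def)
  qed
  hence "Qp_poly p f (padic_limit x)
       = (\<Oplus>\<^bsub>Qp p\<^esub>i\<in>{..degree f}. padic_limit (\<lambda>n. coeff f i * x n ^ i))"
    unfolding Qp_poly_def by simp
  also have "\<dots> = padic_limit (\<Oplus>\<^bsub>padic_Cauchy_ring p\<^esub>i\<in>{..degree f}. (\<lambda>n. coeff f i * x n ^ i))"
    using car by (subst L.hom_finsum) (auto simp: Pi_def o_def)
  also have "\<dots> = padic_limit (\<lambda>n. poly f (x n))"
    using car by (subst Cauchy_ring_finsum) (auto simp: poly_altdef)
  finally show ?thesis .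
qed

lemma padic_limit_diff:
  assumes "x \<in> carrier (padic_Cauchy_ring p)" "y \<in> carrier (padic_Cauchy_ring p)"
  shows "padic_limit x \<ominus>\<^bsub>Qp p\<^esub> padic_limit y = padic_limit (\<lambda>n. x n - y n)"
  using L.hom_add[OF assms(1) C.a_inv_closed[OF assms(2)]] assms
  by (simp add: a_minus_def Cauchy_ring_a_inv flip: L.hom_a_inv)

text \<open>
  Any representative of the coset differs from \<open>x\<close> by a null sequence, so by the triangle inequality
  its absolute values have the same limit.
\<close>

lemma Qp_abs_padic_limit:
  assumes x: "x \<in> carrier (padic_Cauchy_ring p)" 
    and r: "(\<lambda>n. padic_abs_rat p (x n)) \<longlonglongrightarrow> r"
  shows "Qp_abs p (padic_limit x) = r"
proof -
  have "(\<lambda>n. padic_abs_rat p (y n)) \<longlonglongrightarrow> r" if "y \<in> padic_limit x" for y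
  proof -
    obtain z where z: "z \<in> padic_null p" "y = (\<lambda>n. z n + x n)"
      using \<open>y \<in> padic_limit x\<close> unfolding padic_limit_def a_r_coset_def' by auto
    have z0: "(\<lambda>n. padic_abs_rat p (z n)) \<longlonglongrightarrow> 0" using z by (simp add: padic_null_def)
    have *: "padic_abs_rat p (x n) \<le> padic_abs_rat p (y n) + padic_abs_rat p (z n)" for n
      using padic_abs_rat_triangle[of "y n" "- z n"] z by simp
    show ?thesis
    proof (rule tendsto_sandwich)
      show "(\<lambda>n. padic_abs_rat p (x n) - padic_abs_rat p (z n)) \<longlonglongrightarrow> r"
        using tendsto_diff[OF r z0] by simp
      show "(\<lambda>n. padic_abs_rat p (z n) + padic_abs_rat p (x n)) \<longlonglongrightarrow> r"
        using tendsto_add[OF z0 r] by simp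
      show "\<forall>\<^sub>F n in sequentially. padic_abs_rat p (x n) - padic_abs_rat p (z n) \<le> padic_abs_rat p (y n)"
        using * by (auto simp: algebra_simps)
      show "\<forall>\<^sub>F n in sequentially. padic_abs_rat p (y n) \<le> padic_abs_rat p (z n) + padic_abs_rat p (x n)"
        using z padic_abs_rat_triangle by simp
    qed
  qed
  moreover have "x \<in> padic_limit x" using N.a_rcos_self[OF x] by (simp add: padic_limit_def)
  ultimately show ?thesis 
    unfolding Qp_abs_def by (intro the_equality) (auto intro: LIMSEQ_unique)
qed

end


section \<open>The tetranomial as a difference of squares\<close>

text \<open>
  The exponent \<open>M\<close> for which the rescaled root equations read \<open>y\<^sup>2 = (\<epsilon>^M * (1 + y)^m)\<^sup>2\<close>.
\<close>

definition scale_exp :: "nat \<Rightarrow> nat \<Rightarrow> nat" where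
  "scale_exp h m = (h - 1) * m + 1"

lemma poly_ftet_scaled:
  fixes \<epsilon> y :: "'a :: field"
  assumes "\<epsilon> \<noteq> 0" "h \<ge> 1"
  shows "poly (ftet h (2 * m) \<epsilon>) (\<epsilon> ^ (h - 1) * (1 + y))
       = ((\<epsilon> ^ scale_exp h m * (1 + y) ^ m)\<^sup>2 - y\<^sup>2) / \<epsilon>\<^sup>2"
proof -
  obtain k where h: "h = Suc k" using assms(2) by (cases h) auto
  have e1: "\<epsilon> powi (- 2 * int h) = 1 / (\<epsilon> ^ h)\<^sup>2"
  proof -
    have "- 2 * int h = - int (h * 2)" by simp
    thus ?thesis by (metis power_int_minus power_int_of_nat power_mult inverse_eq_divide)
  qed
  have e2: "\<epsilon> powi (- (int h + 1)) = 1 / (\<epsilon> ^ h * \<epsilon>)"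
  proof -
    have "- (int h + 1) = - int (Suc h)" by simp
    thus ?thesis by (metis power_int_minus power_int_of_nat power_Suc2 inverse_eq_divide)
  qed
  have e3: "\<epsilon> powi (- 2) = 1 / \<epsilon>\<^sup>2"
    by (simp add: power_int_minus inverse_eq_divide)
  have "poly (ftet h (2 * m) \<epsilon>) x = (x ^ m)\<^sup>2 - (x / \<epsilon> ^ h - 1 / \<epsilon>)\<^sup>2" for x
    unfolding ftet_def e1 e2 e3 using assms(1)
    by (simp add: poly_monom power_mult power2_diff power_divide algebra_simps flip: power_mult)
  moreover have "\<epsilon> ^ (h - 1) * (1 + y) / \<epsilon> ^ h - 1 / \<epsilon> = y / \<epsilon>"
    using assms(1) by (simp add: h field_simps)
  moreover have "(\<epsilon> ^ (h - 1) * (1 + y)) ^ m = \<epsilon> ^ scale_exp h m * (1 + y) ^ m / \<epsilon>"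
    using assms(1) by (simp add: scale_exp_def power_mult_distrib power_mult)
  ultimately show ?thesis by (simp add: power_divide diff_divide_distrib)
qed

lemma admissibleE:
  assumes "admissible h d"
  obtains m where "d = 2 * m" "m \<ge> 2" "h \<ge> 3"
  using assms unfolding admissible_def by (auto elim!: evenE)

lemma coeff_ftet:
  assumes "d \<ge> 4"
  shows "coeff (ftet h d \<epsilon>) i =
    (if i = d then 1 else if i = 2 then - (\<epsilon> powi (- 2 * int h))
     else if i = 1 then 2 * \<epsilon> powi (- (int h + 1)) else if i = 0 then - (\<epsilon> powi (- 2)) else 0)"
  using assms unfolding ftet_def by auto

lemma tetranomial_ftet:
  fixes \<epsilon> :: "'a :: field_char_0"
  assumes "d \<ge> 4" "\<epsilon> \<noteq> 0"
  shows "tetranomial (ftet h d \<epsilon>)"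
proof -
  have "{i. coeff (ftet h d \<epsilon>) i \<noteq> 0} = {d, 2, 1, 0}"
    using assms by (auto simp: coeff_ftet)
  thus ?thesis using assms by (simp add: tetranomial_def)
qed

lemma ln_Hmax:
  assumes "e > 0"
  shows "ln (Hmax h e) = 2 * real h * \<bar>ln e\<bar>"
proof -
  have "e powi (2 * int h) = exp (2 * real h * ln e)" "e powi (- 2 * int h) = exp (- 2 * real h * ln e)"
    using assms by (simp_all add: powr_real_of_int'[symmetric] powr_def)
  moreover have "max (exp a) (exp (-a)) = exp \<bar>a\<bar>" for a :: real by (auto simp: max_def)
  ultimately show ?thesis using assms by (simp add: Hmax_def abs_mult)
qed

text \<open>
  Closeness of the roots to within \<open>exp (- M * L)\<close> suffices, where \<open>L\<close> is \<open>\<bar>ln \<epsilon>\<bar>\<close>. The constant is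
  \<open>1/6\<close> because \<open>h - 1 \<ge> 2/3 * h\<close> for \<open>h \<ge> 3\<close>, so that \<open>M \<ge> 2/3 * h * m\<close>, while
  \<open>d * ln H = 4 * h * m * L\<close>.
\<close>

lemma separation_bound:
  assumes "h \<ge> 3" "L \<ge> 0" "x \<le> - (real (scale_exp h m) * L)"
  shows "\<bar>x\<bar> \<ge> 1 / 6 * (real (2 * m) * (2 * real h * L))"
proof -
  have "real (scale_exp h m) = (real h - 1) * real m + 1"
    using assms(1) by (simp add: scale_exp_def of_nat_diff)
  moreover have "2 / 3 * real h \<le> real h - 1" using assms(1) by simp
  hence "2 / 3 * real h * real m \<le> (real h - 1) * real m" by (rule mult_right_mono) simp
  ultimately have "2 / 3 * real h * real m \<le> real (scale_exp h m)" by linarith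
  hence "2 / 3 * real h * real m * L \<le> real (scale_exp h m) * L" using assms(2) by (rule mult_right_mono)
  hence "2 / 3 * real h * real m * L \<le> \<bar>x\<bar>" using assms(3) by linarith
  thus ?thesis by (simp add: mult_ac)
qed

section \<open>Close real roots\<close>

text \<open>
  With \<open>t = 2^(-M)\<close>, the equation \<open>y = t * (1 + y)^m\<close> has a root in \<open>[0, 2 * t]\<close> because
  \<open>(1 + 2 * t)^m \<le> 2\<close>, and \<open>z = - t * (1 + z)^m\<close> has a root in \<open>[- t, 0]\<close>. So the two roots of the
  tetranomial are at distance at most \<open>2^(-(h-1)) * 3 * t < t\<close>.
\<close>

lemma real_close_roots:
  assumes "admissible h d"
  shows "\<exists>\<zeta>1 \<zeta>2 :: real. \<zeta>1 \<noteq> \<zeta>2 \<and> poly (ftet h d (1/2)) \<zeta>1 = 0 \<and> poly (ftet h d (1/2)) \<zeta>2 = 0 \<and>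
           \<bar>ln \<bar>\<zeta>1 - \<zeta>2\<bar>\<bar> \<ge> 1 / 6 * (real d * ln (Hmax h (1/2)))"
proof -
  obtain m where m: "d = 2 * m" "m \<ge> 2" "h \<ge> 3" using admissibleE[OF assms] .
  define M where "M = scale_exp h m"
  define t where "t = (1/2 :: real) ^ M"
  have t0: "t > 0" by (simp add: t_def)
  \<comment> \<open>Small enough that \<open>(1 + 2 * t)^m \<le> exp (2 * m * t)\<close> stays below \<open>2\<close>.\<close>
  have mt: "real m * t \<le> 1 / 4"
  proof -
    have "2 * m \<le> (h - 1) * m" using m by (intro mult_right_mono) auto
    hence "2 + m \<le> M" using m unfolding M_def scale_exp_def by linarith
    hence "t \<le> (1/2) ^ (2 + m)" unfolding t_def by (intro power_decreasing) auto
    hence "real m * t \<le> real m * (1/2) ^ (2 + m)" by (intro mult_left_mono) auto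
    also have "\<dots> \<le> 2 ^ m * (1/2) ^ (2 + m)"
      using of_nat_less_two_power[of m, where 'a = real] by (intro mult_right_mono) auto
    also have "\<dots> = 1 / 4" by (simp add: power_add field_simps)
    finally show ?thesis .
  qed
  have "t \<le> real m * t" using t0 m by simp
  hence t1: "t \<le> 1 / 4" using mt by simp
  have root: "poly (ftet h d (1/2)) ((1/2) ^ (h - 1) * (1 + y)) = 0"
    if "y = s * t * (1 + y) ^ m" "s\<^sup>2 = 1" for s y
    using that(2) arg_cong[OF that(1), of "\<lambda>y. y\<^sup>2"] m poly_ftet_scaled[of "1/2::real" h m y]
    by (simp add: power_mult_distrib t_def M_def)
  have "\<exists>y. 0 \<le> y \<and> y \<le> 2 * t \<and> y - t * (1 + y) ^ m = 0"
  proof (rule IVT')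
    have "(1 + 2 * t) ^ m \<le> exp (2 * t) ^ m" using t0 by (intro power_mono) auto
    also have "\<dots> = exp (2 * (real m * t))" by (simp add: exp_of_nat_mult[symmetric] mult_ac)
    also have "\<dots> \<le> exp (1/2)" using mt by simp
    also have "\<dots> \<le> 2" by (rule exp_half_le2)
    finally show "0 \<le> 2 * t - t * (1 + 2 * t) ^ m" using t0 by (simp add: mult.commute)
  qed (use t0 in \<open>auto intro!: continuous_intros\<close>)
  then obtain y where y: "0 \<le> y" "y \<le> 2 * t" "y = t * (1 + y) ^ m" by auto
  have "\<exists>z. - t \<le> z \<and> z \<le> 0 \<and> z + t * (1 + z) ^ m = 0"
  proof (rule IVT')
    have "(1 - t) ^ m \<le> 1" using t0 t1 by (intro power_le_one) auto
    thus "- t + t * (1 + - t) ^ m \<le> 0" using t0 by simp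
  qed (use t0 in \<open>auto intro!: continuous_intros\<close>)
  then obtain z where z: "- t \<le> z" "z \<le> 0" "z = - t * (1 + z) ^ m" by auto
  have ypos: "y > 0" using y t0 by (metis add_pos_nonneg less_numeral_extra(1) mult_pos_pos zero_less_power)
  define \<delta> where "\<delta> = (1/2) ^ (h - 1) * (1 + y) - (1/2) ^ (h - 1) * (1 + z)"
  have \<delta>: "\<delta> = (1/2) ^ (h - 1) * (y - z)" by (simp add: \<delta>_def algebra_simps)
  have \<delta>0: "\<delta> > 0" using ypos z by (simp add: \<delta>)
  have "\<delta> \<le> (1/2) ^ 2 * (3 * t)"
    unfolding \<delta> using m y z ypos by (intro mult_mono power_decreasing) auto
  also have "\<dots> \<le> t" using t0 by (simp add: power2_eq_square)
  finally have "ln \<delta> \<le> ln t" using \<delta>0 by simp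
  also have "ln t = - (real (scale_exp h m) * ln 2)" 
    by (simp add: t_def M_def ln_realpow ln_div)
  finally have "\<bar>ln \<delta>\<bar> \<ge> 1 / 6 * (real (2 * m) * (2 * real h * ln 2))"
    using m by (intro separation_bound) auto
  moreover have "ln (Hmax h (1/2)) = 2 * real h * ln 2" by (simp add: ln_Hmax ln_div)
  ultimately have "\<bar>ln \<bar>\<delta>\<bar>\<bar> \<ge> 1 / 6 * (real d * ln (Hmax h (1/2)))" using \<delta>0 m by simp
  thus ?thesis using \<delta>0 root[of y 1] root[of z "-1"] y z unfolding \<delta>_def
    by (intro exI[of _ "(1/2) ^ (h - 1) * (1 + y)"] exI[of _ "(1/2) ^ (h - 1) * (1 + z)"]) auto
qed

section \<open>Close p-adic roots\<close>

text \<open>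
  Iteration of \<open>y \<mapsto> q * (1 + y)^m\<close>. It is done over the integers, where convergence is divisibility
  by growing powers of \<open>q\<close>: two points congruent modulo \<open>q^n\<close> have images congruent modulo
  \<open>q^(n+1)\<close>.
\<close>

fun root_seq :: "int \<Rightarrow> nat \<Rightarrow> nat \<Rightarrow> int" where
  "root_seq q m 0 = 0"
| "root_seq q m (Suc n) = q * (1 + root_seq q m n) ^ m"

lemma dvd_root_seq: "q dvd root_seq q m n"
  by (cases n) auto

lemma root_seq_step: "q ^ Suc n dvd root_seq q m (Suc n) - root_seq q m n"
proof (induction n)
  case (Suc n)
  have "root_seq q m (Suc n) - root_seq q m n dvd (1 + root_seq q m (Suc n)) ^ m - (1 + root_seq q m n) ^ m"
    using power_diff_sumr2[of "1 + root_seq q m (Suc n)" m "1 + root_seq q m n"]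
    by (simp del: root_seq.simps)
  hence "q ^ Suc n dvd (1 + root_seq q m (Suc n)) ^ m - (1 + root_seq q m n) ^ m"
    using Suc dvd_trans by blast
  hence "q * q ^ Suc n dvd q * ((1 + root_seq q m (Suc n)) ^ m - (1 + root_seq q m n) ^ m)"
    by (rule mult_dvd_mono[OF dvd_refl])
  thus ?case unfolding root_seq.simps(2)[of q m "Suc n"] root_seq.simps(2)[of q m n]
    by (simp only: power_Suc right_diff_distrib)
qed auto

lemma root_seq_Cauchy: "n \<le> k \<Longrightarrow> q ^ Suc n dvd root_seq q m k - root_seq q m n"
proof (induction k rule: dec_induct)
  case (step k)
  have "q ^ Suc n dvd root_seq q m (Suc k) - root_seq q m k"
    using root_seq_step[of q k m] step by (meson Suc_le_mono le_imp_power_dvd dvd_trans)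
  from dvd_add[OF this step.IH] show ?case by simp
qed auto

lemma inverse_prime_power_less:
  assumes "prime p" "e > 0"
  obtains N where "1 / real p ^ N < e"
  using real_arch_pow_inv[OF assms(2), of "1 / real p"] prime_gt_1_real[OF assms(1)]
  by (auto simp: power_one_over)

lemma root_seq_carrier:
  assumes p: "prime p" and q: "int p dvd q"
  shows "(\<lambda>n. of_int (root_seq q m n)) \<in> carrier (padic_Cauchy_ring p)"
proof (rule carrier_CauchyI[OF p])
  fix e :: real assume "e > 0"
  then obtain N where N: "1 / real p ^ N < e" using inverse_prime_power_less[OF p] by blast
  have *: "padic_abs_rat p (of_int (root_seq q m k) - of_int (root_seq q m N)) < e" if "k \<ge> N" for k
  proof -
    have "int p ^ N dvd q ^ Suc N" using q by (meson dvd_power_same le_imp_power_dvd dvd_trans le_SucI order_refl)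
    hence "int p ^ N dvd root_seq q m k - root_seq q m N"
      using root_seq_Cauchy[OF that] dvd_trans by blast
    thus ?thesis using padic_abs_rat_of_int_le_iff[OF p, of "root_seq q m k - root_seq q m N" N] N by simp
  qed
  have "padic_abs_rat p (of_int (root_seq q m k) - of_int (root_seq q m l)) < e" if "k \<ge> N" "l \<ge> N" for k l
    using padic_abs_rat_add_less[OF p *[OF that(1)], of "of_int (root_seq q m N) - of_int (root_seq q m l)"]
      *[OF that(2)] padic_abs_rat_diff_commute[OF p] by simp
  thus "\<exists>N. \<forall>k\<ge>N. \<forall>l\<ge>N. padic_abs_rat p (of_int (root_seq q m k) - of_int (root_seq q m l)) < e"
    by blast
qed

text \<open>The iterates in the original coordinate \<open>x = p^(h-1) * (1 + y)\<close>.\<close>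

definition padic_root_seq :: "nat \<Rightarrow> nat \<Rightarrow> nat \<Rightarrow> int \<Rightarrow> nat \<Rightarrow> rat" where
  "padic_root_seq p h m q n = of_nat p ^ (h - 1) * (1 + of_int (root_seq q m n))"

lemma padic_root_seq_carrier:
  assumes p: "prime p" and q: "int p dvd q"
  shows "padic_root_seq p h m q \<in> carrier (padic_Cauchy_ring p)"
  using Cauchy_mult[OF p Cauchy_const[OF p] Cauchy_add[OF p Cauchy_const[OF p] root_seq_carrier[OF p q]]]
  unfolding padic_root_seq_def[abs_def] .

text \<open>
  At the \<open>n\<close>-th term the tetranomial takes the value \<open>((y (n+1))\<^sup>2 - (y n)\<^sup>2) / p\<^sup>2\<close>, because the
  square in \<open>poly_ftet_scaled\<close> is that of the next iterate for either sign \<open>s\<close>. These values tend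
  to \<open>0\<close> since the differences of consecutive iterates do, and the denominator only costs the constant factor \<open>p\<^sup>2\<close>.
\<close>

lemma padic_root_seq_root:
  fixes m :: nat
  assumes p: "prime p" and h: "h \<ge> 1" and s: "s\<^sup>2 = 1"
  defines "q \<equiv> s * int p ^ scale_exp h m"
  shows "Qp_poly p (ftet h (2 * m) (of_nat p)) (padic_limit p (padic_root_seq p h m q)) = \<zero>\<^bsub>Qp p\<^esub>"
proof -
  let ?y = "root_seq q m"
  have q: "int p dvd q" by (simp add: q_def scale_exp_def)
  have p0: "(of_nat p :: rat) \<noteq> 0" using prime_gt_0_nat[OF p] by simp
  have val: "poly (ftet h (2 * m) (of_nat p)) (padic_root_seq p h m q n)
           = of_int ((?y (Suc n))\<^sup>2 - (?y n)\<^sup>2) / (of_nat p)\<^sup>2" for n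
  proof -
    have "(?y (Suc n))\<^sup>2 = (int p ^ scale_exp h m * (1 + ?y n) ^ m)\<^sup>2"
      using s by (simp add: q_def power_mult_distrib)
    thus ?thesis
      unfolding padic_root_seq_def poly_ftet_scaled[OF p0 h] of_int_diff by simp
  qed
  have "(\<lambda>n. poly (ftet h (2 * m) (of_nat p)) (padic_root_seq p h m q n)) \<in> padic_null p"
  proof (rule padic_nullI[OF p])
    show "\<forall>\<^sub>F n in sequentially. padic_abs_rat p (poly (ftet h (2 * m) (of_nat p)) (padic_root_seq p h m q n))
            \<le> (1 / real p) ^ n * (real p)\<^sup>2"
    proof (intro always_eventually allI)
      fix n
      have "int p ^ n dvd q ^ Suc n" using q by (meson dvd_power_same le_imp_power_dvd dvd_trans le_SucI order_refl)
      hence "int p ^ n dvd (?y (Suc n) - ?y n) * (?y (Suc n) + ?y n)"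
        using root_seq_step dvd_trans dvd_mult2 by blast
      hence "int p ^ n dvd (?y (Suc n))\<^sup>2 - (?y n)\<^sup>2" by (simp add: power2_eq_square algebra_simps)
      hence le: "padic_abs_rat p (of_int ((?y (Suc n))\<^sup>2 - (?y n)\<^sup>2)) \<le> 1 / real p ^ n"
        by (simp add: padic_abs_rat_of_int_le_iff[OF p] del: root_seq.simps of_int_diff of_int_power)
      have "padic_abs_rat p ((of_nat p)\<^sup>2) * (real p)\<^sup>2 = 1"
        using prime_gt_0_nat[OF p] by (simp add: padic_abs_rat_power[OF p] padic_abs_rat_prime[OF p] power_divide)
      hence "padic_abs_rat p (poly (ftet h (2 * m) (of_nat p)) (padic_root_seq p h m q n))
           = padic_abs_rat p (poly (ftet h (2 * m) (of_nat p)) (padic_root_seq p h m q n) * (of_nat p)\<^sup>2) * (real p)\<^sup>2"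
        by (simp add: padic_abs_rat_mult[OF p])
      also have "\<dots> = padic_abs_rat p (of_int ((?y (Suc n))\<^sup>2 - (?y n)\<^sup>2)) * (real p)\<^sup>2"
        unfolding val using p0 by simp
      also have "\<dots> \<le> 1 / real p ^ n * (real p)\<^sup>2" using le by (rule mult_right_mono) simp
      finally show "padic_abs_rat p (poly (ftet h (2 * m) (of_nat p)) (padic_root_seq p h m q n))
            \<le> (1 / real p) ^ n * (real p)\<^sup>2" by (simp add: power_one_over)
    qed
    show "(\<lambda>n. (1 / real p) ^ n * (real p)\<^sup>2) \<longlonglongrightarrow> 0"
      using prime_gt_1_real[OF p] by (intro tendsto_mult_left_zero LIMSEQ_power_zero) simp
  qed
  thus ?thesis by (simp add: Qp_poly_padic_limit[OF p padic_root_seq_carrier[OF p q]] padic_limit_eq_zero[OF p])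
qed

text \<open>
  The difference is \<open>p^(h-1) * p^M * (2 + e)\<close> with an error \<open>e\<close> divisible by \<open>p^M\<close>. As \<open>M \<ge> 2\<close>, this
  error is smaller than \<open>2\<close> in absolute value even for \<open>p = 2\<close>, so the ultrametric inequality makes
  the absolute value of the second factor exactly that of \<open>2\<close>. The shift to \<open>Suc n\<close> skips the
  common starting point of the two iterations.
\<close>

lemma padic_root_seq_separation:
  assumes p: "prime p" and h: "h \<ge> 3" and m: "m \<ge> 2"
  defines "q \<equiv> int p ^ scale_exp h m"
  shows "padic_abs_rat p (padic_root_seq p h m q (Suc n) - padic_root_seq p h m (- q) (Suc n))
       = 1 / real p ^ (h - 1 + scale_exp h m) * padic_abs_rat p 2"
proof -
  let ?a = "(1 + root_seq q m n) ^ m + (1 + root_seq (- q) m n) ^ m"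
  have one: "q dvd (1 + y) ^ m - 1" if "q dvd y" for y :: int
    using that power_diff_sumr2[of "1 + y" m 1] by (simp add: dvd_mult2)
  have "2 * m \<le> (h - 1) * m" using h by (intro mult_right_mono) auto
  hence "2 \<le> scale_exp h m" using m unfolding scale_exp_def by linarith
  hence "int p ^ 2 dvd q" unfolding q_def by (rule le_imp_power_dvd)
  moreover have "q dvd ((1 + root_seq q m n) ^ m - 1) + ((1 + root_seq (- q) m n) ^ m - 1)"
    using one dvd_root_seq[of q m n] dvd_root_seq[of "- q" m n] by (intro dvd_add) auto
  moreover have "((1 + root_seq q m n) ^ m - 1) + ((1 + root_seq (- q) m n) ^ m - 1) = ?a - 2" by simp
  ultimately have "int p ^ 2 dvd ?a - 2" by (metis dvd_trans)
  hence "padic_abs_rat p (of_int (?a - 2)) \<le> 1 / real p ^ 2"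
    by (simp only: padic_abs_rat_of_int_le_iff[OF p])
  also have "\<dots> < padic_abs_rat p (of_int 2)"
  proof -
    have "\<not> int p ^ 2 dvd 2"
    proof
      assume "int p ^ 2 dvd 2"
      hence "int p ^ 2 \<le> 2" by (rule zdvd_imp_le) simp
      moreover have "int p ^ 2 \<ge> 2 ^ 2" using prime_ge_2_nat[OF p] by (intro power_mono) auto
      ultimately show False by simp
    qed
    thus ?thesis unfolding padic_abs_rat_of_int_le_iff[OF p, symmetric] by simp
  qed
  finally have "padic_abs_rat p (of_int 2 + of_int (?a - 2)) = padic_abs_rat p (of_int 2)"
    by (rule padic_abs_rat_add_eq[OF p])
  hence a: "padic_abs_rat p (of_int ?a) = padic_abs_rat p 2" by simp
  have "padic_root_seq p h m q (Suc n) - padic_root_seq p h m (- q) (Suc n)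
      = of_nat p ^ (h - 1) * of_nat p ^ scale_exp h m * of_int ?a"
    by (simp add: padic_root_seq_def q_def algebra_simps)
  thus ?thesis 
    by (simp only: padic_abs_rat_mult[OF p] a padic_abs_rat_power[OF p] padic_abs_rat_prime[OF p]
          power_add power_one_over) simp
qed

lemma padic_close_roots:
  assumes p: "prime p" and adm: "admissible h d"
  shows "\<exists>\<zeta>1\<in>carrier (Qp p). \<exists>\<zeta>2\<in>carrier (Qp p).
           \<zeta>1 \<noteq> \<zeta>2 \<and>
           Qp_poly p (ftet h d (of_nat p)) \<zeta>1 = \<zero>\<^bsub>Qp p\<^esub> \<and>
           Qp_poly p (ftet h d (of_nat p)) \<zeta>2 = \<zero>\<^bsub>Qp p\<^esub> \<and>
           \<bar>ln (Qp_abs p (\<zeta>1 \<ominus>\<^bsub>Qp p\<^esub> \<zeta>2))\<bar> \<ge> 1 / 6 * (real d * ln (Hmax h (real p)))"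
proof -
  obtain m where m: "d = 2 * m" "m \<ge> 2" "h \<ge> 3" using admissibleE[OF adm] .
  define q where "q = int p ^ scale_exp h m"
  define \<zeta> where "\<zeta> s = padic_limit p (padic_root_seq p h m (s * q))" for s
  define r where "r = 1 / real p ^ (h - 1 + scale_exp h m) * padic_abs_rat p 2"
  have p1: "real p > 1" using prime_gt_1_real[OF p] .
  have car: "padic_root_seq p h m (s * q) \<in> carrier (padic_Cauchy_ring p)" for s
    by (rule padic_root_seq_carrier[OF p]) (simp add: q_def scale_exp_def)
  have root: "Qp_poly p (ftet h d (of_nat p)) (\<zeta> s) = \<zero>\<^bsub>Qp p\<^esub>" if "s\<^sup>2 = 1" for s
    using padic_root_seq_root[OF p _ that, of h m] m by (simp add: \<zeta>_def q_def)
  have dist: "Qp_abs p (\<zeta> s \<ominus>\<^bsub>Qp p\<^esub> \<zeta> s') = l"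
    if "(\<lambda>n. padic_abs_rat p (padic_root_seq p h m (s * q) (Suc n) - padic_root_seq p h m (s' * q) (Suc n))) \<longlonglongrightarrow> l"
    for s s' l
  proof -
    note car' = Cauchy_add[OF p car Cauchy_uminus[OF p car], of s s']
    have "(\<lambda>n. padic_abs_rat p (padic_root_seq p h m (s * q) n - padic_root_seq p h m (s' * q) n)) \<longlonglongrightarrow> l"
      using that by (subst (asm) filterlim_sequentially_Suc)
    thus ?thesis using car' unfolding \<zeta>_def padic_limit_diff[OF p car car]
      by (intro Qp_abs_padic_limit[OF p]) auto
  qed
  have abs_r: "Qp_abs p (\<zeta> 1 \<ominus>\<^bsub>Qp p\<^esub> \<zeta> (-1)) = r"
    using padic_root_seq_separation[OF p m(3,2)] by (intro dist) (simp add: q_def r_def)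
  \<comment> \<open>A root has distance \<open>0\<close> from itself, so a nonzero distance \<open>r\<close> tells the two roots apart.\<close>
  have abs_0: "Qp_abs p (\<zeta> 1 \<ominus>\<^bsub>Qp p\<^esub> \<zeta> 1) = 0" by (intro dist) simp
  have two: "0 < padic_abs_rat p 2" "padic_abs_rat p 2 \<le> 1"
    using padic_abs_rat_nonneg[OF p, of 2] padic_abs_rat_eq_0_iff[OF p, of 2] padic_abs_rat_of_int_le_1[OF p, of 2]
    by auto
  have r0: "r > 0" using two p1 by (simp add: r_def)
  have "r \<le> 1 / real p ^ (h - 1 + scale_exp h m)"
    using two p1 unfolding r_def by (simp add: divide_right_mono)
  also have "\<dots> \<le> 1 / real p ^ scale_exp h m"
    using p1 by (intro divide_left_mono power_increasing) auto
  finally have "ln r \<le> ln (1 / real p ^ scale_exp h m)" using r0 p1 by simp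
  also have "\<dots> = - (real (scale_exp h m) * ln (real p))" using p1 by (simp add: ln_div ln_realpow)
  finally have "\<bar>ln r\<bar> \<ge> 1 / 6 * (real (2 * m) * (2 * real h * ln (real p)))"
    using m p1 by (intro separation_bound) auto
  hence "\<bar>ln r\<bar> \<ge> 1 / 6 * (real d * ln (Hmax h (real p)))" using m p1 by (simp add: ln_Hmax)
  moreover have "\<zeta> s \<in> carrier (Qp p)" for s unfolding \<zeta>_def by (rule padic_limit_closed[OF p car])
  moreover have "\<zeta> 1 \<noteq> \<zeta> (-1)" using abs_r abs_0 r0 by auto
  ultimately show ?thesis
    unfolding abs_r[symmetric]
    by (intro bexI[of _ "\<zeta> 1"] bexI[of _ "\<zeta> (-1)"] conjI root) simp_all
qed

section \<open>Sizes of the coefficients\<close>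

lemma floorlog_le_of_le_power:
  assumes "b > 1" "\<bar>z\<bar> \<le> int b ^ k"
  shows "floorlog b (nat \<bar>z\<bar>) \<le> k + 1"
proof -
  have "nat \<bar>z\<bar> \<le> b ^ k" using assms(2) by (simp add: nat_le_iff)
  from floorlog_mono[OF this, of b] show ?thesis
    using assms(1) floorlog_power[of b 1 k] by (simp add: floorlog_def)
qed

text \<open>
  The right-hand side is \<open>4 * ln H\<close>. From \<open>ln b \<ge> ln 2 \<ge> 1/2\<close> it is at least \<open>4 * h\<close>, which exceeds
  \<open>2 * h + 1\<close>.
\<close>

lemma coeff_digits_bound:
  assumes "h \<ge> 3" "b \<ge> 2" "k \<le> 2 * h"
  shows "real (k + 1) \<le> 4 * (2 * real h * ln (real b))"
proof -
  have "1 / 2 \<le> ln (2::real)" using exp_half_le2 ln_ge_iff[of 2 "1/2"] by linarith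
  also have "ln 2 \<le> ln (real b)" using assms by simp
  finally have "8 * real h * (1 / 2) \<le> 8 * real h * ln (real b)" by (intro mult_left_mono) auto
  moreover have "real (k + 1) \<le> 8 * real h * (1 / 2)" using assms by simp
  ultimately show ?thesis by linarith
qed

lemma floorlog_coeff_le:
  assumes "h \<ge> 3" "b \<ge> 2" "\<bar>z\<bar> \<le> int b ^ (2 * h)"
  shows "real (floorlog b (nat \<bar>z\<bar>)) \<le> 4 * (2 * real h * ln (real b))"
  using floorlog_le_of_le_power[of b z "2 * h"] coeff_digits_bound[of h b "2 * h"] assms by simp

lemma coeff_digits_padic:
  assumes p: "prime p" and adm: "admissible h d"
  shows "\<exists>z::int. coeff (smult (of_nat p ^ (2 * h)) (ftet h d (of_nat p :: rat))) i = of_int z \<and>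
           real (floorlog p (nat \<bar>z\<bar>)) \<le> 4 * ln (Hmax h (real p))"
proof -
  have h: "h \<ge> 3" and d: "d \<ge> 4" using adm by (auto simp: admissible_def)
  have p2: "p \<ge> 2" using prime_ge_2_nat[OF p] .
  have p0: "(of_nat p :: rat) \<noteq> 0" using p2 by simp
  define z where "z = (if i = d then int p ^ (2 * h) else if i = 2 then -1 else if i = 1 then 2 * int p ^ (h - 1)
     else if i = 0 then - (int p ^ (2 * h - 2)) else 0)"
  have shift: "(of_nat p :: rat) ^ (2 * h) * of_nat p powi e = of_nat p ^ n"
    if "int n = int (2 * h) + e" for e n
    by (metis that p0 power_int_add power_int_of_nat)
  have "coeff (smult (of_nat p ^ (2 * h)) (ftet h d (of_nat p :: rat))) i = of_int z"
    using shift[of 0 "- 2 * int h"] shift[of "h - 1" "- (int h + 1)"] shift[of "2 * h - 2" "- 2"] h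
    by (simp add: coeff_ftet[OF d] z_def)
  moreover have "\<bar>z\<bar> \<le> int p ^ (2 * h)"
  proof -
    have "2 * int p ^ (h - 1) \<le> int p * int p ^ (h - 1)" using p2 by (intro mult_right_mono) auto
    also have "\<dots> = int p ^ h" using h by (cases h) auto
    also have "\<dots> \<le> int p ^ (2 * h)" using p2 by (intro power_increasing) auto
    finally have "2 * int p ^ (h - 1) \<le> int p ^ (2 * h)" .
    moreover have "int p ^ (2 * h - 2) \<le> int p ^ (2 * h)" using p2 by (intro power_increasing) auto
    moreover have "1 \<le> int p ^ (2 * h)" using p2 by simp
    ultimately show ?thesis by (auto simp: z_def)
  qed
  ultimately show ?thesis using floorlog_coeff_le[OF h p2] p2 by (intro exI[of _ z]) (simp add: ln_Hmax)
qed

lemma coeff_digits_real: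
  assumes adm: "admissible h d"
  shows "\<exists>z::int. coeff (ftet h d (1/2 :: real)) i = of_int z \<and>
           real (floorlog 2 (nat \<bar>z\<bar>)) \<le> 4 * ln (Hmax h (1/2))"
proof -
  have h: "h \<ge> 3" and d: "d \<ge> 4" using adm by (auto simp: admissible_def)
  define z :: int where "z = (if i = d then 1 else if i = 2 then - (2 ^ (2 * h)) else if i = 1 then 2 ^ (h + 2)
     else if i = 0 then - 4 else 0)"
  have pow: "(1/2 :: real) powi e = 2 ^ k" if "e = - int k" for e k
    unfolding that by (simp add: power_int_minus power_one_over)
  have "coeff (ftet h d (1/2 :: real)) i = of_int z"
    using pow[of "- 2 * int h" "2 * h"] pow[of "- (int h + 1)" "h + 1"] pow[of "- 2" 2]
    by (simp add: coeff_ftet[OF d] z_def del: minus_add_distrib)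
  moreover have "\<bar>z\<bar> \<le> int 2 ^ (2 * h)"
  proof -
    have "(2::int) ^ (h + 2) \<le> 2 ^ (2 * h)" "(2::int) ^ 2 \<le> 2 ^ (2 * h)"
      using h by (intro power_increasing; simp)+
    thus ?thesis by (auto simp: z_def)
  qed
  ultimately show ?thesis using floorlog_coeff_le[OF h, of 2 z] by (intro exI[of _ z]) (simp add: ln_Hmax ln_div)
qed

section \<open>Roots at distance exponentially small in the degree\<close>

theorem theorem1p4:
  shows
    "(\<forall>(p::nat) h d. prime p \<longrightarrow> admissible h d \<longrightarrow> tetranomial (ftet h d (of_nat p :: rat))) \<and>
     (\<forall>h d. admissible h d \<longrightarrow> tetranomial (ftet h d (1/2 :: real))) \<and>
     (\<exists>c>0. \<forall>(p::nat) h d. prime p \<longrightarrow> admissible h d \<longrightarrow>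
        (\<exists>\<zeta>1\<in>carrier (Qp p). \<exists>\<zeta>2\<in>carrier (Qp p).
           \<zeta>1 \<noteq> \<zeta>2 \<and>
           Qp_poly p (ftet h d (of_nat p)) \<zeta>1 = \<zero>\<^bsub>Qp p\<^esub> \<and>
           Qp_poly p (ftet h d (of_nat p)) \<zeta>2 = \<zero>\<^bsub>Qp p\<^esub> \<and>
           \<bar>ln (Qp_abs p (\<zeta>1 \<ominus>\<^bsub>Qp p\<^esub> \<zeta>2))\<bar> \<ge> c * (real d * ln (Hmax h (real p))))) \<and>
     (\<exists>c>0. \<forall>h d. admissible h d \<longrightarrow>
        (\<exists>\<zeta>1 \<zeta>2 :: real.
           \<zeta>1 \<noteq> \<zeta>2 \<and>
           poly (ftet h d (1/2)) \<zeta>1 = 0 \<and>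
           poly (ftet h d (1/2)) \<zeta>2 = 0 \<and>
           \<bar>ln \<bar>\<zeta>1 - \<zeta>2\<bar>\<bar> \<ge> c * (real d * ln (Hmax h (1/2))))) \<and>
     (\<exists>C>0. \<forall>(p::nat) h d. prime p \<longrightarrow> admissible h d \<longrightarrow>
        (\<forall>i. \<exists>z::int.
           coeff (smult (of_nat p ^ (2 * h)) (ftet h d (of_nat p :: rat))) i = of_int z \<and>
           real (floorlog p (nat \<bar>z\<bar>)) \<le> C * ln (Hmax h (real p)))) \<and>
     (\<exists>C>0. \<forall>h d. admissible h d \<longrightarrow>
        (\<forall>i. \<exists>z::int.
           coeff (ftet h d (1/2 :: real)) i = of_int z \<and>
           real (floorlog 2 (nat \<bar>z\<bar>)) \<le> C * ln (Hmax h (1/2))))"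
proof (intro conjI)
  show "\<forall>(p::nat) h d. prime p \<longrightarrow> admissible h d \<longrightarrow> tetranomial (ftet h d (of_nat p :: rat))"
    by (auto intro!: tetranomial_ftet simp: admissible_def)
  show "\<forall>h d. admissible h d \<longrightarrow> tetranomial (ftet h d (1/2 :: real))"
    by (auto intro!: tetranomial_ftet simp: admissible_def)
next
  have "(1/6 :: real) > 0" by simp
  with padic_close_roots show "\<exists>c>0. \<forall>(p::nat) h d. prime p \<longrightarrow> admissible h d \<longrightarrow>
        (\<exists>\<zeta>1\<in>carrier (Qp p). \<exists>\<zeta>2\<in>carrier (Qp p).
           \<zeta>1 \<noteq> \<zeta>2 \<and>
           Qp_poly p (ftet h d (of_nat p)) \<zeta>1 = \<zero>\<^bsub>Qp p\<^esub> \<and>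
           Qp_poly p (ftet h d (of_nat p)) \<zeta>2 = \<zero>\<^bsub>Qp p\<^esub> \<and>
           \<bar>ln (Qp_abs p (\<zeta>1 \<ominus>\<^bsub>Qp p\<^esub> \<zeta>2))\<bar> \<ge> c * (real d * ln (Hmax h (real p))))"
    by blast
  from \<open>(1/6 :: real) > 0\<close> real_close_roots show "\<exists>c>0. \<forall>h d. admissible h d \<longrightarrow>
        (\<exists>\<zeta>1 \<zeta>2 :: real.
           \<zeta>1 \<noteq> \<zeta>2 \<and>
           poly (ftet h d (1/2)) \<zeta>1 = 0 \<and>
           poly (ftet h d (1/2)) \<zeta>2 = 0 \<and>
           \<bar>ln \<bar>\<zeta>1 - \<zeta>2\<bar>\<bar> \<ge> c * (real d * ln (Hmax h (1/2))))"
    by blast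
next
  have "(4 :: real) > 0" by simp
  with coeff_digits_padic show "\<exists>C>0. \<forall>(p::nat) h d. prime p \<longrightarrow> admissible h d \<longrightarrow>
        (\<forall>i. \<exists>z::int.
           coeff (smult (of_nat p ^ (2 * h)) (ftet h d (of_nat p :: rat))) i = of_int z \<and>
           real (floorlog p (nat \<bar>z\<bar>)) \<le> C * ln (Hmax h (real p)))"
    by blast
  from \<open>(4 :: real) > 0\<close> coeff_digits_real show "\<exists>C>0. \<forall>h d. admissible h d \<longrightarrow>
        (\<forall>i. \<exists>z::int.
           coeff (ftet h d (1/2 :: real)) i = of_int z \<and>
           real (floorlog 2 (nat \<bar>z\<bar>)) \<le> C * ln (Hmax h (1/2)))"
    by blast
qed

end
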